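(* For every integer $n\geq 1$, $$F_{n}(y,t)=\frac{1}{1+t}\left(\frac{(1+y)^{n}}{t}A_{n}(t^{2})+\sum_{k=0}^{n}\binom{n}{k}(1+y)^{k}(1-t^{2})^{n-k}A_{k}(t^{2})\right).$$
   Context: $\mathfrak{S}_n$ is the set of permutations $\pi=\pi_1\cdots\pi_n$ of $[n]=\{1,\dots,n\}$, $\mathrm{des}(\pi)$ is the number of $i\in[n-1]$ with $\pi_i>\pi_{i+1}$, and the Eulerian polynomials are $A_n(t)=\sum_{\pi\in\mathfrak{S}_n}t^{\mathrm{des}(\pi)+1}$ for $n\ge1$ and $A_0(t)=1$. $\mathfrak{B}_n$ is the set of signed permutations: permutations $\pi$ of $\{-n,\dots,-1,0,1,\dots,n\}$ with $\pi_{-i}=-\pi_i$ for all $i$ (so $\pi_0=0$), written $\pi=\pi_1\cdots\pi_n$. For $\pi\in\mathfrak{B}_n$: $\mathrm{des}_B(\pi)$ is the number of $i\in\{0,1,\dots,n-1\}$ with $\pi_i>\pi_{i+1}$ (where $\pi_0=0$); the flag descent number $\mathrm{fdes}(\pi)$ is $2\,\mathrm{des}_B(\pi)$ if $\pi_1>0$ and $2\,\mathrm{des}_B(\pi)-1$ if $\pi_1<0$; $\mathrm{neg}(\pi)$ is the number of $i\in[n]$ with $\pi_i<0$. $F_n(y,t)=\sum_{\pi\in\mathfrak{B}_n}y^{\mathrm{neg}(\pi)}t^{\mathrm{fdes}(\pi)}$ for $n\ge1$. The identity is one of rational functions in the indeterminates $y,t$. *)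

theory Defs
  imports
    "HOL-Combinatorics.Combinatorics"
    "HOL-Computational_Algebra.Computational_Algebra"
begin

definition des :: "nat \<Rightarrow> (nat \<Rightarrow> nat) \<Rightarrow> nat" where
  "des n p = card {i \<in> {1..n - 1}. p i > p (i + 1)}"

text \<open>
  The value of the Eulerian polynomial at an element of a commutative ring; the exponent is
  \<open>des + 1\<close>, so that the polynomial of index 1 is \<open>x\<close>, while the polynomial of index 0 is 1.
\<close>

definition eulerian :: "nat \<Rightarrow> 'a::comm_ring_1 \<Rightarrow> 'a" where
  "eulerian n x =
     (if n = 0 then 1 else (\<Sum>p \<in> {p. p permutes {1..n}}. x ^ (des n p + 1)))"

text \<open>
  A signed permutation is a function on all integers that is the identity outside \<open>{-n..n}\<close>;
  this makes the function representing it unique.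
\<close>

definition signed_perms :: "nat \<Rightarrow> (int \<Rightarrow> int) set" where
  "signed_perms n =
     {p. p permutes {- int n..int n} \<and> (\<forall>i \<in> {- int n..int n}. p (- i) = - p i)}"

definition des_B :: "nat \<Rightarrow> (int \<Rightarrow> int) \<Rightarrow> nat" where
  "des_B n p = card {i \<in> {0..int n - 1}. p i > p (i + 1)}"

text \<open>
  The subtraction on naturals does not truncate for a signed permutation with \<open>n \<ge> 1\<close>:
  if \<open>p 1 < 0 = p 0\<close>, then 0 is a descent, so \<open>des_B n p \<ge> 1\<close>.
\<close>

definition fdes :: "nat \<Rightarrow> (int \<Rightarrow> int) \<Rightarrow> nat" where
  "fdes n p = (if p 1 < 0 then 2 * des_B n p - 1 else 2 * des_B n p)"

definition neg :: "nat \<Rightarrow> (int \<Rightarrow> int) \<Rightarrow> nat" where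
  "neg n p = card {i \<in> {1..int n}. p i < 0}"

definition flag_poly :: "nat \<Rightarrow> 'a::comm_ring_1 \<Rightarrow> 'a \<Rightarrow> 'a" where
  "flag_poly n y t = (\<Sum>p \<in> signed_perms n. y ^ neg n p * t ^ fdes n p)"

text \<open>
  The field of rational functions in two indeterminates over the rationals, as the fraction
  field of the polynomial ring \<open>\<int>[y][t]\<close>.
\<close>

type_synonym ratfun2 = "int poly poly fract"

definition Y :: ratfun2 where
  "Y = Fract [:[:0, 1:]:] 1"

definition T :: ratfun2 where
  "T = Fract [:0, 1:] 1"

end

theory Submission
  imports Defs
begin

text \<open>
  Let \<open>d\<close> be the number of descents of \<open>\<pi>\<close> at the positions \<open>1, \<dots>, n - 1\<close>. Whatever the sign of
  \<open>\<pi>\<^sub>1\<close>, the monomial \<open>t (1 + t) t^fdes\<close> equals \<open>(t^2)^(d + 1) + t (t^2)^des_B\<close>, so the identity splits into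
  \<open>\<Sum> y^neg x^(d + 1) = (1 + y)^n A\<^sub>n(x)\<close> and an expansion of \<open>\<Sum> y^neg x^des_B\<close>. For both, fix
  the set \<open>J\<close> of negated values, so that \<open>\<pi>\<close> runs over all orderings of a set of \<open>n\<close> integers. This
  settles the first identity. For the second, the descents of the word \<open>0 \<pi>\<^sub>1 \<dots> \<pi>\<^sub>n\<close> are enumerated by
  \<open>\<Sum>\<^sub>U (1 - x)^|U| A\<^bsub>n-|U|\<^esub>(x)\<close> over the sets \<open>U\<close> of letters exceeding 0, that is
  \<open>U \<subseteq> [n] - J\<close>, and summing over \<open>J\<close> first gives the claim.
\<close>

section \<open>Descents of words over a linear order\<close>

fun des_list :: "'a::linorder list \<Rightarrow> nat" where
  "des_list (x # y # zs) = (if y < x then 1 else 0) + des_list (y # zs)"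
| "des_list _ = 0"

text \<open>The recursion of \<open>des_list\<close> works at the front of a word, whereas lists
  \<open>[a..<b]\<close> grow at the end; this serves the induction on \<open>b\<close>.\<close>

lemma des_list_append2:
  "des_list (xs @ [x, y]) = des_list (xs @ [x]) + (if y < x then 1 else 0)"
  by (induction xs rule: des_list.induct) auto

lemma des_list_map_upt:
  "a \<le> b \<Longrightarrow> des_list (map f [a..<Suc b]) = card {i \<in> {a..<b}. f (Suc i) < f i}"
proof (induction b rule: dec_induct)
  case base
  then show ?case by simp
next
  case (step b)
  have "map f [a..<Suc (Suc b)] = map f [a..<b] @ [f b, f (Suc b)]"
    using step.hyps by simp
  moreover have "map f [a..<Suc b] = map f [a..<b] @ [f b]"
    using step.hyps by simp
  ultimately have "des_list (map f [a..<Suc (Suc b)]) =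
      card {i \<in> {a..<b}. f (Suc i) < f i} + (if f (Suc b) < f b then 1 else 0)"
    using step.IH by (simp add: des_list_append2)
  also have "\<dots> = card {i \<in> {a..<Suc b}. f (Suc i) < f i}"
  proof -
    have "{i \<in> {a..<Suc b}. f (Suc i) < f i} =
        {i \<in> {a..<b}. f (Suc i) < f i} \<union> (if f (Suc b) < f b then {b} else {})"
      using step.hyps by (auto simp: less_Suc_eq)
    then show ?thesis by simp
  qed
  finally show ?case .
qed

lemma des_list_map_strict_mono:
  fixes h :: "'a::linorder \<Rightarrow> 'b::linorder"
  assumes "strict_mono_on A h" "set xs \<subseteq> A"
  shows "des_list (map h xs) = des_list xs"
  using assms(2)
  by (induction xs rule: des_list.induct)
     (auto simp: strict_mono_on_less[OF assms(1)])

section \<open>Orderings of a finite set and Eulerian polynomials\<close>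

text \<open>The exponent lacks the \<open>+ 1\<close> of \<open>eulerian\<close>, so for nonempty
  \<open>S\<close> this is the Eulerian polynomial of index \<open>card S\<close> without one factor
  \<open>x\<close>.\<close>

definition word_sum :: "'a::comm_ring_1 \<Rightarrow> 'b::linorder set \<Rightarrow> 'a" where
  "word_sum x S = (\<Sum>w \<in> permutations_of_set S. x ^ des_list w)"

text \<open>The letter \<open>a\<close> stands for what precedes the ordering: at first the value 0
  at position 0, later in the recursion the letter just split off.\<close>

definition word_sum_from :: "'a::comm_ring_1 \<Rightarrow> 'b::linorder \<Rightarrow> 'b set \<Rightarrow> 'a" where
  "word_sum_from x a S = (\<Sum>w \<in> permutations_of_set S. x ^ des_list (a # w))"

lemma word_sum_image_strict_mono:
  assumes "strict_mono_on A h"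
  shows "word_sum x (h ` A) = word_sum x A"
proof -
  have inj: "inj_on h A"
    using assms by (rule strict_mono_on_imp_inj_on)
  have "inj_on (map h) (permutations_of_set A)"
    by (rule inj_onI) (metis inj inj_on_map_eq_map permutations_of_setD(1) sup.idem)
  then show ?thesis
    unfolding word_sum_def permutations_of_set_image_inj[OF inj]
    by (simp add: sum.reindex des_list_map_strict_mono[OF assms] permutations_of_setD)
qed

text \<open>The increasing enumeration of \<open>S\<close> lets each letter be replaced by its rank,
  which preserves all comparisons.\<close>

lemma word_sum_card_cong:
  fixes S :: "'b::linorder set"
  assumes "finite S"
  shows "word_sum x S = word_sum x {..<card S}"
proof -
  let ?h = "\<lambda>i. sorted_list_of_set S ! i"
  have len: "length (sorted_list_of_set S) = card S"
    by simp
  have "strict_mono_on {..<card S} ?h"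
    using strict_sorted_list_of_set[of S] len
    by (auto intro!: strict_mono_onI simp: sorted_wrt_nth_less)
  moreover have "?h ` {..<card S} = S"
    using assms nth_image[of "card S" "sorted_list_of_set S"] len
    by (simp add: atLeast0LessThan)
  ultimately show ?thesis
    by (metis word_sum_image_strict_mono)
qed

text \<open>A permutation that is the identity outside \<open>{1..n}\<close> is determined by its
  word. Surjectivity follows by counting, both sides having n! elements.\<close>

lemma bij_betw_permutes_words:
  "bij_betw (\<lambda>p. map p [1..<Suc n]) {p. p permutes {1..n}} (permutations_of_set {1..n})"
  unfolding bij_betw_def
proof
  show inj: "inj_on (\<lambda>p. map p [1..<Suc n]) {p. p permutes {1..n}}"
  proof (rule inj_onI)
    fix p q assume pq: "p \<in> {p. p permutes {1..n}}" "q \<in> {p. p permutes {1..n}}"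
      and eq: "map p [1..<Suc n] = map q [1..<Suc n]"
    show "p = q"
    proof
      fix i
      show "p i = q i"
      proof (cases "i \<in> {1..n}")
        case True
        then have "i \<in> set [1..<Suc n]" by auto
        then show ?thesis using eq unfolding map_eq_conv by blast
      next
        case False
        then show ?thesis using pq by (metis mem_Collect_eq permutes_not_in)
      qed
    qed
  qed
  have sub: "(\<lambda>p. map p [1..<Suc n]) ` {p. p permutes {1..n}} \<subseteq> permutations_of_set {1..n}"
  proof
    fix w assume "w \<in> (\<lambda>p. map p [1..<Suc n]) ` {p. p permutes {1..n}}"
    then obtain p where p: "p permutes {1..n}" and w: "w = map p [1..<Suc n]" by auto
    have s: "set [1..<Suc n] = {1..n}" by auto
    show "w \<in> permutations_of_set {1..n}"
      using p unfolding w permutations_of_set_def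
      by (simp only: mem_Collect_eq set_map s permutes_image distinct_map distinct_upt
            permutes_inj_on simp_thms)
  qed
  show "(\<lambda>p. map p [1..<Suc n]) ` {p. p permutes {1..n}} = permutations_of_set {1..n}"
    by (rule card_subset_eq[OF _ sub]) (simp_all only: card_image[OF inj]
        finite_permutations_of_set card_permutations_of_set finite_atLeastAtMost
        card_permutations[OF refl] card_atLeastAtMost)
qed

text \<open>Relabelling turns \<open>S\<close> into \<open>{1..n}\<close>, and the factor
  \<open>x\<close> accounts for the exponent \<open>des + 1\<close>. The empty set is excluded
  because there the right side would be \<open>x\<close>, while
  \<open>eulerian 0 x = 1\<close>.\<close>

lemma eulerian_card:
  assumes "finite S" "S \<noteq> {}"
  shows "eulerian (card S) x = x * word_sum x S"
proof -
  define n where "n = card S"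
  have n: "n \<ge> 1"
    using assms by (simp add: n_def Suc_le_eq card_gt_0_iff)
  have "word_sum x S = word_sum x {..<n}"
    unfolding n_def by (rule word_sum_card_cong[OF assms(1)])
  also have "\<dots> = word_sum x {1..n}"
    using word_sum_card_cong[of "{1..n}" x] by simp
  also have "\<dots> = (\<Sum>p \<in> {p. p permutes {1..n}}. x ^ des_list (map p [1..<Suc n]))"
    unfolding word_sum_def by (rule sum.reindex_bij_betw[OF bij_betw_permutes_words, symmetric])
  also have "\<dots> = (\<Sum>p \<in> {p. p permutes {1..n}}. x ^ des n p)"
  proof (intro sum.cong refl arg_cong[of _ _ "power x"])
    fix p :: "nat \<Rightarrow> nat"
    have "{i \<in> {1..<n}. p (Suc i) < p i} = {i \<in> {1..n - 1}. p i > p (i + 1)}"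
      by auto
    then show "des_list (map p [1..<Suc n]) = des n p"
      unfolding des_def des_list_map_upt[OF n] by simp
  qed
  finally show ?thesis
    using n unfolding eulerian_def n_def[symmetric] by (simp add: sum_distrib_left)
qed

section \<open>Recursion on the first letter\<close>

lemma sum_permutations_of_set_Cons:
  assumes "finite S" "S \<noteq> {}"
  shows "(\<Sum>w \<in> permutations_of_set S. f w) =
         (\<Sum>b \<in> S. \<Sum>w \<in> permutations_of_set (S - {b}). f (b # w))"
proof -
  have "sum f (permutations_of_set S) =
      (\<Sum>b \<in> S. sum f ((#) b ` permutations_of_set (S - {b})))"
    unfolding permutations_of_set_nonempty[OF assms(2)]
    by (rule sum.UNION_disjoint) (use assms(1) in auto)
  then show ?thesis
    by (simp add: sum.reindex)
qed

lemma word_sum_rec: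
  assumes "finite S" "S \<noteq> {}"
  shows "word_sum x S = (\<Sum>b \<in> S. word_sum_from x b (S - {b}))"
  unfolding word_sum_def word_sum_from_def by (rule sum_permutations_of_set_Cons[OF assms])

lemma word_sum_from_rec:
  assumes "finite S" "S \<noteq> {}"
  shows "word_sum_from x a S =
    (\<Sum>b \<in> S. x ^ (if b < a then 1 else 0) * word_sum_from x b (S - {b}))"
  unfolding word_sum_from_def sum_permutations_of_set_Cons[OF assms] sum_distrib_left
  by (simp add: power_add)

text \<open>A nonempty subset splits uniquely into its minimum and a set of larger elements. This
  collects the terms of the recursion for \<open>word_sum_from\<close>, grouped by the first letter
  \<open>b\<close>, into one sum over nonempty subsets.\<close>

lemma bij_betw_insert_Min_Pow:
  fixes S :: "'b::linorder set"
  assumes "finite S"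
  shows "bij_betw (\<lambda>(b, U). insert b U) (SIGMA b:S. Pow {s \<in> S. b < s}) (Pow S - {{}})"
proof (rule bij_betw_byWitness[where f' = "\<lambda>U. (Min U, U - {Min U})"])
  show "\<forall>bU \<in> (SIGMA b:S. Pow {s \<in> S. b < s}).
      (Min (case bU of (b, U) \<Rightarrow> insert b U), (case bU of (b, U) \<Rightarrow> insert b U) - {Min (case bU of (b, U) \<Rightarrow> insert b U)}) = bU"
  proof
    fix bU assume bU: "bU \<in> (SIGMA b:S. Pow {s \<in> S. b < s})"
    then obtain b U where eq: "bU = (b, U)" and U: "U \<subseteq> {s \<in> S. b < s}" by auto
    have "finite U" using U finite_subset[OF _ assms, of U] by auto
    then have "Min (insert b U) = b" "b \<notin> U"
      using U by (auto intro!: Min_eqI)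
    then show "(Min (case bU of (b, U) \<Rightarrow> insert b U), (case bU of (b, U) \<Rightarrow> insert b U) - {Min (case bU of (b, U) \<Rightarrow> insert b U)}) = bU"
      by (simp add: eq)
  qed
  show "\<forall>U \<in> Pow S - {{}}. (case (Min U, U - {Min U}) of (b, U) \<Rightarrow> insert b U) = U"
    using assms by (auto simp: insert_absorb Min_in finite_subset[OF _ assms])
  show "(\<lambda>(b, U). insert b U) ` (SIGMA b:S. Pow {s \<in> S. b < s}) \<subseteq> Pow S - {{}}"
    by auto
  show "(\<lambda>U. (Min U, U - {Min U})) ` (Pow S - {{}}) \<subseteq> (SIGMA b:S. Pow {s \<in> S. b < s})"
  proof (rule image_subsetI)
    fix U assume U: "U \<in> Pow S - {{}}"
    then have fin: "finite U" using assms finite_subset by blast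
    then have "Min U \<in> S" using U Min_in by blast
    moreover have "Min U < s" if "s \<in> U - {Min U}" for s
      using that fin Min_le[of U s] by (auto simp: order.strict_iff_order)
    ultimately show "(Min U, U - {Min U}) \<in> (SIGMA b:S. Pow {s \<in> S. b < s})"
      using U by auto
  qed
qed

text \<open>
  The recursion on the first letter \<open>b\<close> weighs it by \<open>x\<close> if \<open>b < a\<close> and by \<open>1 = x + (1 - x)\<close> if
  \<open>a < b\<close>. The terms with \<open>x\<close> add up to the Eulerian polynomial (\<open>U = {}\<close>), those with \<open>1 - x\<close>
  to the sets \<open>U\<close> with minimum \<open>b\<close>.
\<close>

lemma word_sum_from_eq:
  fixes S :: "'b::linorder set"
  assumes "finite S" "a \<notin> S"
  shows "word_sum_from x a S =
    (\<Sum>U \<in> Pow {s \<in> S. a < s}. (1 - x) ^ card U * eulerian (card S - card U) x)"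
  using assms
proof (induction "card S" arbitrary: a S rule: less_induct)
  case less
  show ?case
  proof (cases "S = {}")
    case True
    then show ?thesis
      by (simp add: word_sum_from_def eulerian_def)
  next
    case False
    let ?g = "\<lambda>U. (1 - x) ^ card U * eulerian (card S - card U) x"
    let ?R = "{s \<in> S. a < s}"
    have finR: "finite ?R" using less.prems by simp
    \<comment> \<open>Adjoining \<open>b\<close> to \<open>U\<close> raises its size by one. This
      absorbs the factor \<open>1 - x\<close> and offsets the removal of \<open>b\<close> from
      \<open>S\<close> in the index of the Eulerian polynomial.\<close>
    have IH: "(1 - x) * word_sum_from x b (S - {b}) = (\<Sum>U \<in> Pow {s \<in> ?R. b < s}. ?g (insert b U))"
      if b: "b \<in> ?R" for b
    proof -
      have eq: "{s \<in> S - {b}. b < s} = {s \<in> ?R. b < s}"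
        using b by auto
      have lt: "card (S - {b}) < card S"
        using b less.prems by (intro psubset_card_mono) auto
      have "word_sum_from x b (S - {b}) =
          (\<Sum>U \<in> Pow {s \<in> ?R. b < s}. (1 - x) ^ card U * eulerian (card (S - {b}) - card U) x)"
        using less.hyps[OF lt] less.prems eq by simp
      also have "(1 - x) * \<dots> = (\<Sum>U \<in> Pow {s \<in> ?R. b < s}. ?g (insert b U))"
        unfolding sum_distrib_left
      proof (rule sum.cong[OF refl])
        fix U assume "U \<in> Pow {s \<in> ?R. b < s}"
        then have "finite U" "b \<notin> U" using finite_subset[OF _ less.prems(1), of U] by auto
        then have "card (insert b U) = Suc (card U)" by simp
        moreover have "card (S - {b}) = card S - 1" using b less.prems by simp
        ultimately show "(1 - x) * ((1 - x) ^ card U * eulerian (card (S - {b}) - card U) x) = ?g (insert b U)"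
          by (simp add: mult.assoc)
      qed
      finally show ?thesis .
    qed
    have "word_sum_from x a S =
        (\<Sum>b \<in> S. x * word_sum_from x b (S - {b}) +
          (if a < b then (1 - x) * word_sum_from x b (S - {b}) else 0))"
      unfolding word_sum_from_rec[OF less.prems(1) False]
    proof (rule sum.cong[OF refl])
      fix b assume "b \<in> S"
      then have "a \<noteq> b" using less.prems by auto
      then show "x ^ (if b < a then 1 else 0) * word_sum_from x b (S - {b}) =
          x * word_sum_from x b (S - {b}) + (if a < b then (1 - x) * word_sum_from x b (S - {b}) else 0)"
        by (cases "a < b") (auto simp: algebra_simps)
    qed
    also have "\<dots> = x * word_sum x S + (\<Sum>b \<in> ?R. (1 - x) * word_sum_from x b (S - {b}))"
      using less.prems(1)
      by (simp add: sum.distrib word_sum_rec[OF less.prems(1) False] sum_distrib_left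
            sum.inter_filter)
    also have "(\<Sum>b \<in> ?R. (1 - x) * word_sum_from x b (S - {b})) =
        (\<Sum>b \<in> ?R. \<Sum>U \<in> Pow {s \<in> ?R. b < s}. ?g (insert b U))"
      by (rule sum.cong[OF refl IH])
    also have "\<dots> = (\<Sum>(b, U) \<in> (SIGMA b:?R. Pow {s \<in> ?R. b < s}). ?g (insert b U))"
      using less.prems(1) by (intro sum.Sigma) auto
    also have "\<dots> = (\<Sum>U \<in> Pow ?R - {{}}. ?g U)"
      using sum.reindex_bij_betw[OF bij_betw_insert_Min_Pow[OF finR], of ?g]
      by (simp add: case_prod_unfold)
    also have "x * word_sum x S = ?g {}"
      using eulerian_card[OF less.prems(1) False, of x] by simp
    finally show ?thesis
      using finR by (simp add: sum.remove[of "Pow ?R" "{}" ?g])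
  qed
qed

section \<open>Value sets of signed permutations\<close>

text \<open>The entries at positions 1 to \<open>n\<close> of a signed permutation whose negative
  entries have exactly the absolute values in \<open>J\<close>.\<close>

definition signed_set :: "nat \<Rightarrow> int set \<Rightarrow> int set" where
  "signed_set n J = uminus ` J \<union> ({1..int n} - J)"

lemma finite_signed_set: "J \<subseteq> {1..int n} \<Longrightarrow> finite (signed_set n J)"
  by (auto simp: signed_set_def intro: finite_subset)

lemma card_signed_set:
  assumes "J \<subseteq> {1..int n}"
  shows "card (signed_set n J) = n"
proof -
  have fin: "finite J" using assms finite_subset by blast
  have "card (signed_set n J) = card (uminus ` J) + card ({1..int n} - J)"
    unfolding signed_set_def using assms fin by (intro card_Un_disjoint) auto
  also have "\<dots> = card J + (card {1..int n} - card J)"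
    using assms fin by (simp add: card_image card_Diff_subset)
  also have "\<dots> = n"
    using card_mono[OF _ assms] by simp
  finally show ?thesis .
qed

lemma signed_set_neg: "J \<subseteq> {1..int n} \<Longrightarrow> {s \<in> signed_set n J. s < 0} = uminus ` J"
  by (auto simp: signed_set_def)

lemma signed_set_pos: "J \<subseteq> {1..int n} \<Longrightarrow> {s \<in> signed_set n J. 0 < s} = {1..int n} - J"
  by (auto simp: signed_set_def)

text \<open>Negating the negative elements of \<open>signed_set n J\<close> recovers
  \<open>J\<close>.\<close>

lemma signed_set_inj: "inj_on (signed_set n) (Pow {1..int n})"
proof (rule inj_onI)
  fix J K assume "J \<in> Pow {1..int n}" "K \<in> Pow {1..int n}" "signed_set n J = signed_set n K"
  then have "uminus ` J = uminus ` K"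
    using signed_set_neg[of J n] signed_set_neg[of K n] by simp
  then show "J = K" by (simp add: inj_image_eq_iff)
qed

text \<open>Used to extend an ordering of \<open>signed_set n J\<close> to an odd map: values stay
  in range, differ from the value at 0, and never clash between positive and negative
  arguments.\<close>

lemma signed_setD:
  assumes "J \<subseteq> {1..int n}" "s \<in> signed_set n J"
  shows "s \<in> {- int n..int n}" "s \<noteq> 0" "- s \<notin> signed_set n J"
proof -
  have "1 \<le> x \<and> x \<le> int n" if "x \<in> J" for x using that assms(1) by auto
  from this[of s] this[of "- s"] this show "s \<in> {- int n..int n}" "s \<noteq> 0" "- s \<notin> signed_set n J"
    using assms(2) by (fastforce simp: signed_set_def)+
qed

section \<open>One-line notation of signed permutations\<close>

definition word_of :: "nat \<Rightarrow> (int \<Rightarrow> int) \<Rightarrow> int list" where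
  "word_of n p = map (\<lambda>i. p (int i)) [1..<Suc n]"

lemma image_int_Icc_1: "int ` {1..n} = {1..int n}"
  using image_int_atLeastAtMost[of 1 n] by simp

lemma set_word_of: "set (word_of n p) = p ` {1..int n}"
proof -
  have "set (word_of n p) = p ` int ` {1..n}"
    unfolding word_of_def by (auto simp del: upt_Suc)
  then show ?thesis by (simp only: image_int_Icc_1)
qed

text \<open>Oddness is required only on the interval in \<open>signed_perms\<close>; it extends to
  all integers since a signed permutation is the identity elsewhere.\<close>

lemma signed_permsD:
  assumes "p \<in> signed_perms n"
  shows "p permutes {- int n..int n}" "p (- i) = - p i" "p 0 = 0"
proof -
  show perm: "p permutes {- int n..int n}" using assms by (simp add: signed_perms_def)
  show odd: "p (- i) = - p i" for i
  proof (cases "i \<in> {- int n..int n}")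
    case True
    then show ?thesis using assms by (simp add: signed_perms_def)
  next
    case False
    then have "- i \<notin> {- int n..int n}" by auto
    then show ?thesis using False permutes_not_in[OF perm] by metis
  qed
  show "p 0 = 0" using odd[of 0] by simp
qed

text \<open>\<open>J\<close> consists of the absolute values of the negative entries. Inclusion in
  \<open>signed_set n J\<close> is enough, because both sets have \<open>n\<close> elements.\<close>

lemma signed_perms_image:
  assumes "p \<in> signed_perms n"
  obtains J where "J \<subseteq> {1..int n}" "p ` {1..int n} = signed_set n J"
proof -
  let ?N = "{1..int n}"
  define J where "J = {j \<in> ?N. - j \<in> p ` ?N}"
  note p = signed_permsD[OF assms]
  have inj: "p i = p j \<longleftrightarrow> i = j" for i j
    using p(1) by (metis permutes_inj injD)
  have J: "J \<subseteq> ?N" by (auto simp: J_def)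
  have "p ` ?N \<subseteq> signed_set n J"
  proof
    fix s assume "s \<in> p ` ?N"
    then obtain i where i: "i \<in> ?N" "s = p i" by auto
    have "s \<noteq> 0" using i inj[of i 0] p(3) by simp
    have "s \<in> {- int n..int n}"
      using i permutes_in_image[OF p(1), of i] by auto
    show "s \<in> signed_set n J"
    proof (cases "s < 0")
      case True
      then have "- s \<in> J" using i \<open>s \<in> {- int n..int n}\<close> by (auto simp: J_def)
      then show ?thesis by (force simp: signed_set_def)
    next
      case False
      have "- s \<notin> p ` ?N"
      proof
        assume "- s \<in> p ` ?N"
        then obtain k where k: "k \<in> ?N" "- s = p k" by auto
        \<comment> \<open>Oddness yields equal values at arguments of opposite sign, against
          injectivity.\<close>
        then have "p (- k) = p i" using p(2)[of k] i by simp
        then show False using inj[of "- k" i] k i by simp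
      qed
      then show ?thesis
        using False \<open>s \<noteq> 0\<close> \<open>s \<in> {- int n..int n}\<close> by (auto simp: signed_set_def J_def)
    qed
  qed
  moreover have "card (p ` ?N) = card (signed_set n J)"
    using permutes_inj_on[OF p(1)] by (simp add: card_image card_signed_set[OF J])
  ultimately have "p ` ?N = signed_set n J"
    by (intro card_subset_eq finite_signed_set J)
  then show ?thesis using that J by blast
qed

text \<open>The values at positive arguments determine all others: oddness gives those at 0 and at
  negative arguments, and outside the interval both maps are the identity.\<close>

lemma word_of_inj: "inj_on (word_of n) (signed_perms n)"
proof (rule inj_onI, rule ext)
  fix p q i assume p: "p \<in> signed_perms n" and q: "q \<in> signed_perms n"
    and eq: "word_of n p = word_of n q"
  have pos: "p j = q j" if "j \<in> {1..int n}" for j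
  proof -
    have "nat j \<in> set [1..<Suc n]" using that by auto
    then have "p (int (nat j)) = q (int (nat j))"
      using eq unfolding word_of_def map_eq_conv by blast
    then show ?thesis using that by simp
  qed
  consider "i \<in> {1..int n}" | "- i \<in> {1..int n}" | "i = 0" | "i \<notin> {- int n..int n}"
    by fastforce
  then show "p i = q i"
  proof cases
    case 1
    then show ?thesis by (rule pos)
  next
    case 2
    then show ?thesis
      using pos signed_permsD(2)[OF p, of i] signed_permsD(2)[OF q, of i] by fastforce
  next
    case 3
    then show ?thesis using signed_permsD(3)[OF p] signed_permsD(3)[OF q] by simp
  next
    case 4
    then show ?thesis
      using permutes_not_in[OF signed_permsD(1)[OF p]] permutes_not_in[OF signed_permsD(1)[OF q]]
      by metis
  qed
qed

text \<open>The witness is the odd extension of \<open>w\<close>, the identity at 0 and outside the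
  interval. On the finite interval it is an injective self-map, hence a permutation.\<close>

lemma word_of_surj:
  assumes J: "J \<subseteq> {1..int n}" and w: "w \<in> permutations_of_set (signed_set n J)"
  obtains p where "p \<in> signed_perms n" "word_of n p = w"
proof -
  let ?N = "{1..int n}"
  have set_w: "set w = signed_set n J" and dist: "distinct w"
    using permutations_of_setD[OF w] by blast+
  have len: "length w = n"
    using distinct_card[OF dist] set_w card_signed_set[OF J] by metis
  \<comment> \<open>Positions start at 1, list indices at 0.\<close>
  define v where "v i = w ! (nat i - 1)" for i
  define p where "p i = (if i \<in> ?N then v i else if - i \<in> ?N then - v (- i) else i)" for i
  have idx: "nat i - 1 < length w" if "i \<in> ?N" for i
    using that unfolding len by auto
  have v: "v i \<in> signed_set n J" if "i \<in> ?N" for i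
    using nth_mem[OF idx[OF that]] unfolding v_def set_w .
  have v_inj: "v i = v k \<longleftrightarrow> i = k" if "i \<in> ?N" "k \<in> ?N" for i k
    using that unfolding v_def nth_eq_iff_index_eq[OF dist idx[OF that(1)] idx[OF that(2)]] by auto
  have v_range: "v i \<in> {- int n..int n}" and v_nz: "v i \<noteq> 0" if "i \<in> ?N" for i
    using signed_setD[OF J v[OF that]] by auto
  have v_neg: "v i \<noteq> - v k" if "i \<in> ?N" "k \<in> ?N" for i k
    using signed_setD(3)[OF J v[OF that(2)]] v[OF that(1)] by metis
  have odd: "p (- i) = - p i" for i
    by (auto simp: p_def)
  have cases: "i \<in> ?N \<or> - i \<in> ?N \<or> i = 0" if "i \<in> {- int n..int n}" for i
    using that by auto
  have p_pos: "p i = v i" if "i \<in> ?N" for i using that by (simp add: p_def)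
  have p_neg: "p i = - v (- i)" if "- i \<in> ?N" for i using that by (auto simp: p_def)
  have p_0: "p 0 = 0" by (simp add: p_def)
  have maps: "p ` {- int n..int n} \<subseteq> {- int n..int n}"
  proof (rule image_subsetI)
    fix i assume "i \<in> {- int n..int n}"
    then consider "i \<in> ?N" | "- i \<in> ?N" | "i = 0" using cases by blast
    then show "p i \<in> {- int n..int n}"
    proof cases
      case 1
      then show ?thesis using v_range by (simp only: p_pos)
    next
      case 2
      then show ?thesis using v_range[OF 2] by (simp add: p_neg)
    qed (simp add: p_0)
  qed
  have "inj_on p {- int n..int n}"
  proof (rule inj_onI)
    fix i k assume i: "i \<in> {- int n..int n}" and k: "k \<in> {- int n..int n}" and eq: "p i = p k"
    \<comment> \<open>Opposite signs of \<open>i\<close> and \<open>k\<close> are excluded by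
      \<open>v_neg\<close>, exactly one of them being 0 by \<open>v_nz\<close>.\<close>
    from cases[OF i] cases[OF k] show "i = k"
    proof (elim disjE)
      assume "i \<in> ?N" "k \<in> ?N" then show ?thesis using eq v_inj by (simp only: p_pos)
    next
      assume "i \<in> ?N" "- k \<in> ?N" then show ?thesis using eq v_neg by (simp only: p_pos p_neg)
    next
      assume "i \<in> ?N" "k = 0" then show ?thesis using eq v_nz by (simp only: p_pos p_0)
    next
      assume "- i \<in> ?N" "k \<in> ?N" then show ?thesis using eq v_neg by (metis p_pos p_neg)
    next
      assume "- i \<in> ?N" "- k \<in> ?N" then show ?thesis using eq v_inj by (metis p_neg neg_equal_iff_equal)
    next
      assume "- i \<in> ?N" "k = 0" then show ?thesis using eq v_nz by (metis p_neg p_0 neg_equal_0_iff_equal)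
    next
      assume "i = 0" "k \<in> ?N" then show ?thesis using eq v_nz by (metis p_pos p_0)
    next
      assume "i = 0" "- k \<in> ?N" then show ?thesis using eq v_nz by (metis p_neg p_0 neg_equal_0_iff_equal)
    next
      assume "i = 0" "k = 0" then show ?thesis by simp
    qed
  qed
  then have "bij_betw p {- int n..int n} {- int n..int n}"
    using endo_inj_surj[OF _ maps] by (simp add: bij_betw_def)
  then have "p permutes {- int n..int n}"
    by (rule bij_imp_permutes) (auto simp: p_def)
  then have "p \<in> signed_perms n"
    using odd by (simp add: signed_perms_def)
  moreover have "word_of n p = w"
    using len by (intro nth_equalityI) (auto simp: word_of_def p_def v_def nat_add_distrib simp del: upt_Suc)
  ultimately show ?thesis using that by blast
qed

lemma bij_betw_word_of:
  "bij_betw (word_of n) (signed_perms n)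
     (\<Union>J \<in> Pow {1..int n}. permutations_of_set (signed_set n J))"
  unfolding bij_betw_def
proof (intro conjI word_of_inj equalityI subsetI)
  fix w assume "w \<in> word_of n ` signed_perms n"
  then obtain p where p: "p \<in> signed_perms n" and w: "w = word_of n p" by auto
  obtain J where "J \<subseteq> {1..int n}" "p ` {1..int n} = signed_set n J"
    using signed_perms_image[OF p] .
  moreover have "distinct w"
    using inj_eq[OF permutes_inj[OF signed_permsD(1)[OF p]]]
    by (simp add: w word_of_def distinct_map inj_on_def del: upt_Suc)
  ultimately show "w \<in> (\<Union>J \<in> Pow {1..int n}. permutations_of_set (signed_set n J))"
    by (auto simp: w permutations_of_set_def set_word_of)
next
  fix w assume "w \<in> (\<Union>J \<in> Pow {1..int n}. permutations_of_set (signed_set n J))"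
  then show "w \<in> word_of n ` signed_perms n"
    using word_of_surj[of _ n w] by (metis PowD UN_E image_eqI)
qed

text \<open>\<open>neg\<close> counts positions, the right side letters; injectivity of
  \<open>p\<close> matches them.\<close>

lemma neg_eq_card_word_of:
  assumes "p \<in> signed_perms n"
  shows "neg n p = card {s \<in> set (word_of n p). s < 0}"
proof -
  have "{s \<in> set (word_of n p). s < 0} = p ` {i \<in> {1..int n}. p i < 0}"
    unfolding set_word_of by auto
  then show ?thesis
    using permutes_inj_on[OF signed_permsD(1)[OF assms]] by (simp add: neg_def card_image)
qed

section \<open>Summation over the sets of negated values\<close>

text \<open>Signed permutations are grouped by their set \<open>J\<close> of negated values, and
  \<open>neg\<close> is \<open>card J\<close> throughout a group. The weight \<open>f\<close> stays
  arbitrary so that descents can be counted both with and without a leading 0.\<close>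

lemma sum_signed_perms:
  fixes f :: "int list \<Rightarrow> 'a::comm_ring_1"
  shows "(\<Sum>p \<in> signed_perms n. y ^ neg n p * f (word_of n p)) =
    (\<Sum>J \<in> Pow {1..int n}. y ^ card J * (\<Sum>w \<in> permutations_of_set (signed_set n J). f w))"
proof -
  let ?P = "\<lambda>J. permutations_of_set (signed_set n J)"
  let ?c = "\<lambda>w. card {s \<in> set w. s < (0::int)}"
  have "(\<Sum>p \<in> signed_perms n. y ^ neg n p * f (word_of n p)) =
      (\<Sum>p \<in> signed_perms n. y ^ ?c (word_of n p) * f (word_of n p))"
    by (simp add: neg_eq_card_word_of)
  also have "\<dots> = (\<Sum>w \<in> (\<Union>J \<in> Pow {1..int n}. ?P J). y ^ ?c w * f w)"
    by (rule sum.reindex_bij_betw[OF bij_betw_word_of])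
  also have "\<dots> = (\<Sum>J \<in> Pow {1..int n}. \<Sum>w \<in> ?P J. y ^ ?c w * f w)"
  proof (rule sum.UNION_disjoint)
    \<comment> \<open>A word determines its set of letters, which in turn determines
      \<open>J\<close>.\<close>
    show "\<forall>J \<in> Pow {1..int n}. \<forall>K \<in> Pow {1..int n}. J \<noteq> K \<longrightarrow> ?P J \<inter> ?P K = {}"
      by (metis IntE equals0I inj_onD permutations_of_setD(1) signed_set_inj)
  qed auto
  also have "\<dots> = (\<Sum>J \<in> Pow {1..int n}. y ^ card J * (\<Sum>w \<in> ?P J. f w))"
    unfolding sum_distrib_left
  proof (intro sum.cong refl)
    fix J w assume "J \<in> Pow {1..int n}" "w \<in> ?P J"
    then have "{s \<in> set w. s < 0} = uminus ` J"
      by (simp add: signed_set_neg permutations_of_setD)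
    then show "y ^ ?c w * f w = y ^ card J * f w"
      by (simp add: card_image)
  qed
  finally show ?thesis .
qed

text \<open>Expansion of a product of factors \<open>1 + y\<close>, one for each element of
  \<open>A\<close>; \<open>J\<close> records where \<open>y\<close> is chosen.\<close>

lemma sum_Pow_power_card:
  fixes y :: "'a::comm_ring_1"
  assumes "finite A"
  shows "(\<Sum>J \<in> Pow A. y ^ card J) = (1 + y) ^ card A"
  using prod_add[OF assms, of "\<lambda>_. y" "\<lambda>_. 1"] by (simp add: add.commute)

lemma sum_Pow_card:
  fixes g :: "nat \<Rightarrow> 'a::comm_ring_1"
  assumes "finite A"
  shows "(\<Sum>U \<in> Pow A. g (card U)) = (\<Sum>k = 0..card A. of_nat (card A choose k) * g k)"
proof -
  have "(\<Sum>U \<in> Pow A. g (card U)) =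
      (\<Sum>k = 0..card A. \<Sum>U \<in> {U \<in> Pow A. card U = k}. g (card U))"
    using assms by (intro sum.group[symmetric]) (auto intro: card_mono)
  also have "\<dots> = (\<Sum>k = 0..card A. of_nat (card A choose k) * g k)"
    using n_subsets[OF assms] by simp
  finally show ?thesis .
qed

text \<open>All sets \<open>signed_set n J\<close> have \<open>n\<close> elements, so the sum over
  orderings is the same for every \<open>J\<close>, and only the sum of \<open>y ^ card J\<close>
  remains.\<close>

lemma signed_des_sum:
  fixes x y :: "'a::comm_ring_1"
  assumes "n \<ge> 1"
  shows "(\<Sum>p \<in> signed_perms n. y ^ neg n p * x ^ (des_list (word_of n p) + 1)) =
    (1 + y) ^ n * eulerian n x"
proof -
  have "(\<Sum>p \<in> signed_perms n. y ^ neg n p * x ^ (des_list (word_of n p) + 1)) =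
      (\<Sum>J \<in> Pow {1..int n}. y ^ card J * (x * word_sum x (signed_set n J)))"
    by (subst sum_signed_perms) (simp add: word_sum_def sum_distrib_left)
  also have "\<dots> = (\<Sum>J \<in> Pow {1..int n}. y ^ card J * eulerian n x)"
  proof (intro sum.cong refl arg_cong2[of _ _ _ _ "(*)"])
    fix J assume "J \<in> Pow {1..int n}"
    then have J: "J \<subseteq> {1..int n}" by simp
    have "signed_set n J \<noteq> {}" using card_signed_set[OF J] assms by auto
    then show "x * word_sum x (signed_set n J) = eulerian n x"
      using eulerian_card[OF finite_signed_set[OF J], of x] card_signed_set[OF J] by simp
  qed
  also have "\<dots> = (1 + y) ^ n * eulerian n x"
    by (simp add: sum_distrib_right[symmetric] sum_Pow_power_card)
  finally show ?thesis .
qed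

text \<open>With 0 as the preceding letter, \<open>word_sum_from_eq\<close> yields a double sum over
  disjoint sets \<open>J\<close> and \<open>U\<close>. For fixed \<open>U\<close>, the sum over
  \<open>J\<close> is a power of \<open>1 + y\<close>.\<close>

lemma signed_des_B_sum:
  fixes x y :: "'a::comm_ring_1"
  shows "(\<Sum>p \<in> signed_perms n. y ^ neg n p * x ^ des_list (0 # word_of n p)) =
    (\<Sum>k = 0..n. of_nat (n choose k) * (1 + y) ^ k * (1 - x) ^ (n - k) * eulerian k x)"
proof -
  let ?N = "{1..int n}"
  let ?g = "\<lambda>k. (1 - x) ^ k * eulerian (n - k) x"
  have "(\<Sum>p \<in> signed_perms n. y ^ neg n p * x ^ des_list (0 # word_of n p)) =
      (\<Sum>J \<in> Pow ?N. y ^ card J * word_sum_from x 0 (signed_set n J))"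
    unfolding word_sum_from_def by (rule sum_signed_perms)
  also have "\<dots> = (\<Sum>J \<in> Pow ?N. \<Sum>U \<in> {U \<in> Pow ?N. J \<inter> U = {}}. y ^ card J * ?g (card U))"
  proof (rule sum.cong[OF refl])
    fix J assume "J \<in> Pow ?N"
    then have J: "J \<subseteq> ?N" by simp
    have "0 \<notin> signed_set n J" using signed_setD(2)[OF J] by blast
    \<comment> \<open>Disjointness is symmetric in \<open>J\<close> and \<open>U\<close>, which
      prepares the interchange of the two sums.\<close>
    moreover have "Pow (?N - J) = {U \<in> Pow ?N. J \<inter> U = {}}" by auto
    ultimately have "word_sum_from x 0 (signed_set n J) = (\<Sum>U \<in> {U \<in> Pow ?N. J \<inter> U = {}}. ?g (card U))"
      using word_sum_from_eq[OF finite_signed_set[OF J], of 0 x]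
      unfolding signed_set_pos[OF J] card_signed_set[OF J] by simp
    then show "y ^ card J * word_sum_from x 0 (signed_set n J) =
        (\<Sum>U \<in> {U \<in> Pow ?N. J \<inter> U = {}}. y ^ card J * ?g (card U))"
      by (simp add: sum_distrib_left)
  qed
  also have "\<dots> = (\<Sum>U \<in> Pow ?N. \<Sum>J \<in> {J \<in> Pow ?N. J \<inter> U = {}}. y ^ card J * ?g (card U))"
    by (rule sum.swap_restrict) auto
  also have "\<dots> = (\<Sum>U \<in> Pow ?N. (1 + y) ^ (n - card U) * ?g (card U))"
  proof (rule sum.cong[OF refl])
    fix U assume "U \<in> Pow ?N"
    then have U: "U \<subseteq> ?N" by simp
    then have fin: "finite U" using finite_subset by blast
    have "{J \<in> Pow ?N. J \<inter> U = {}} = Pow (?N - U)" by auto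
    then have "(\<Sum>J \<in> {J \<in> Pow ?N. J \<inter> U = {}}. y ^ card J) = (1 + y) ^ (n - card U)"
      using sum_Pow_power_card[of "?N - U" y] card_Diff_subset[OF fin U] by simp
    then show "(\<Sum>J \<in> {J \<in> Pow ?N. J \<inter> U = {}}. y ^ card J * ?g (card U)) =
        (1 + y) ^ (n - card U) * ?g (card U)"
      unfolding sum_distrib_right[symmetric] by simp
  qed
  also have "\<dots> = (\<Sum>k = 0..n. of_nat (n choose k) * ((1 + y) ^ (n - k) * ?g k))"
    using sum_Pow_card[of ?N "\<lambda>k. (1 + y) ^ (n - k) * ?g k"] by simp
  \<comment> \<open>From here on \<open>k\<close> is the size of the complement of
    \<open>U\<close>.\<close>
  also have "\<dots> = (\<Sum>k = 0..n. of_nat (n choose (n - k)) * ((1 + y) ^ (n - (n - k)) * ?g (n - k)))"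
    by (rule sum.reindex_bij_witness[of _ "\<lambda>k. n - k" "\<lambda>k. n - k"]) auto
  also have "\<dots> = (\<Sum>k = 0..n. of_nat (n choose k) * (1 + y) ^ k * (1 - x) ^ (n - k) * eulerian k x)"
    by (rule sum.cong[OF refl]) (simp add: binomial_symmetric[symmetric] mult.assoc)
  finally show ?thesis .
qed

section \<open>The flag descent number\<close>

text \<open>As \<open>p 0 = 0\<close>, the leading letter 0 is the entry at position 0, where
  \<open>des_B\<close> starts to count.\<close>

lemma des_B_eq_des_list:
  assumes "p \<in> signed_perms n"
  shows "des_B n p = des_list (0 # word_of n p)"
proof -
  have "0 # word_of n p = map (\<lambda>i. p (int i)) [0..<Suc n]"
    unfolding word_of_def by (simp add: upt_conv_Cons signed_permsD(3)[OF assms] del: upt_Suc)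
  then have "des_list (0 # word_of n p) = card {i \<in> {0..<n}. p (int (Suc i)) < p (int i)}"
    by (simp only: des_list_map_upt[OF le0])
  also have "\<dots> = card (int ` {i \<in> {0..<n}. p (int (Suc i)) < p (int i)})"
    by (simp add: card_image)
  also have "int ` {i \<in> {0..<n}. p (int (Suc i)) < p (int i)} =
      {i \<in> {0..int n - 1}. p i > p (i + 1)}"
  proof (intro equalityI subsetI)
    fix i assume "i \<in> {i \<in> {0..int n - 1}. p i > p (i + 1)}"
    then show "i \<in> int ` {i \<in> {0..<n}. p (int (Suc i)) < p (int i)}"
      by (intro image_eqI[of _ _ "nat i"]) (auto simp: add.commute)
  qed (auto simp: add.commute)
  finally show ?thesis by (simp add: des_B_def)
qed

text \<open>Let \<open>d = des_list (word_of n p)\<close>. If \<open>p 1 < 0\<close>, then 0 is a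
  descent, \<open>fdes n p = 2 * d + 1\<close>, and both sides are
  \<open>t ^ (2 * d + 2) + t ^ (2 * d + 3)\<close>. Otherwise \<open>fdes n p = 2 * d\<close>, and
  both are \<open>t ^ (2 * d + 1) + t ^ (2 * d + 2)\<close>.\<close>

lemma flag_power_split:
  fixes t :: "'a::comm_ring_1"
  assumes "p \<in> signed_perms n" "n \<ge> 1"
  shows "t * (1 + t) * t ^ fdes n p =
    (t ^ 2) ^ (des_list (word_of n p) + 1) + t * (t ^ 2) ^ des_list (0 # word_of n p)"
proof -
  let ?d = "des_list (word_of n p)"
  have "word_of n p = p 1 # map (\<lambda>i. p (int i)) [2..<Suc n]"
    using assms(2) by (simp add: word_of_def upt_conv_Cons numeral_2_eq_2 del: upt_Suc)
  then have B: "des_list (0 # word_of n p) = (if p 1 < 0 then 1 else 0) + ?d"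
    by simp
  then have "fdes n p = (if p 1 < 0 then 2 * ?d + 1 else 2 * ?d)"
    by (simp add: fdes_def des_B_eq_des_list[OF assms(1)])
  then show ?thesis
    unfolding B power_mult[symmetric] by (simp add: algebra_simps)
qed

text \<open>Clearing the denominators \<open>t\<close> and \<open>1 + t\<close> makes the identity
  meaningful in every commutative ring; it is the sum of \<open>flag_power_split\<close> over all
  signed permutations, weighted by \<open>y ^ neg n p\<close>.\<close>

lemma flag_poly_eq:
  fixes t y :: "'a::comm_ring_1"
  assumes "n \<ge> 1"
  shows "t * (1 + t) * flag_poly n y t =
    (1 + y) ^ n * eulerian n (t ^ 2) +
    t * (\<Sum>k = 0..n. of_nat (n choose k) * (1 + y) ^ k * (1 - t ^ 2) ^ (n - k) * eulerian k (t ^ 2))"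
proof -
  have "t * (1 + t) * flag_poly n y t =
      (\<Sum>p \<in> signed_perms n. y ^ neg n p * (t * (1 + t) * t ^ fdes n p))"
    by (simp add: flag_poly_def sum_distrib_left ac_simps)
  also have "\<dots> = (\<Sum>p \<in> signed_perms n. y ^ neg n p * (t ^ 2) ^ (des_list (word_of n p) + 1) +
      t * (y ^ neg n p * (t ^ 2) ^ des_list (0 # word_of n p)))"
    by (intro sum.cong refl)
      (simp only: flag_power_split[OF _ assms] distrib_left[of "y ^ k" for k] mult.left_commute[of _ t])
  finally show ?thesis
    unfolding sum.distrib sum_distrib_left[symmetric] signed_des_sum[OF assms] signed_des_B_sum .
qed

theorem theorem2p8:
  fixes n :: nat
  assumes "n \<ge> 1"
  shows "flag_poly n Y T =
    1 / (1 + T) *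
      ((1 + Y) ^ n / T * eulerian n (T ^ 2) +
       (\<Sum>k = 0..n. of_nat (n choose k) * (1 + Y) ^ k * (1 - T ^ 2) ^ (n - k) * eulerian k (T ^ 2)))"
proof -
  have T: "T \<noteq> 0"
    by (simp add: T_def Zero_fract_def eq_fract)
  have T1: "1 + T \<noteq> 0"
    by (simp add: T_def Zero_fract_def One_fract_def eq_fract one_pCons)
  \<comment> \<open>The common denominator \<open>T * (1 + T)\<close> in expanded form.\<close>
  have "T + T * T \<noteq> 0"
    using T T1 by (metis distrib_left mult.right_neutral no_zero_divisors)
  then show ?thesis
    using flag_poly_eq[OF assms, of T Y] T T1
    by (simp add: field_simps)
qed

end
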